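(* Let $\mathcal{A}$ be a commutative unital C*-algebra and let $n$ be a natural number. If $M, N\in M_n(\mathcal{A})$ are positive, then their Schur product $M\circ N$ is also positive.
   Context: $M_n(\mathcal{A})$ is the *-algebra of $n\times n$ matrices over $\mathcal{A}$ with the natural matrix operations and involution $[a_{j,k}]^*=[a_{k,j}^*]$. On $\mathcal{A}^n$ (column vectors) use the $\mathcal{A}$-valued inner product $\langle (x_j)_{j=1}^n,(y_j)_{j=1}^n\rangle=\sum_{j=1}^n x_jy_j^*$. A matrix $A\in M_n(\mathcal{A})$ is called positive if $A=A^*$ and $\langle Ax,x\rangle\ge 0$ in $\mathcal{A}$ for all $x\in\mathcal{A}^n$. The C*-algebraic Schur product of $A=[a_{j,k}]$ and $B=[b_{j,k}]$ in $M_n(\mathcal{A})$ is $A\circ B=\frac12[a_{j,k}b_{j,k}+b_{j,k}a_{j,k}]_{1\le j,k\le n}$; for commutative $\mathcal{A}$ this equals $[a_{j,k}b_{j,k}]_{1\le j,k\le n}$. *)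

theory Defs
  imports Complex_Main "Jordan_Normal_Form.Matrix"
begin

text \<open>
  Unital C*-algebras as a type class. The class \<^class>\<open>real_normed_algebra_1\<close> contributes the ring
  with unit, the submultiplicative norm and norm 1 = 1 (so the algebra is nonzero); the class
  \<^class>\<open>banach\<close> contributes completeness. Complex scalar multiplication extends the given real one.
\<close>

class cstar_algebra = real_normed_algebra_1 + banach +
  fixes scaleC :: "complex \<Rightarrow> 'a \<Rightarrow> 'a"  (infixr \<open>*\<^sub>C\<close> 75)
    and star :: "'a \<Rightarrow> 'a"
  assumes scaleC_add_right: "z *\<^sub>C (x + y) = z *\<^sub>C x + z *\<^sub>C y"
    and scaleC_add_left: "(z + w) *\<^sub>C x = z *\<^sub>C x + w *\<^sub>C x"
    and scaleC_scaleC: "z *\<^sub>C (w *\<^sub>C x) = (z * w) *\<^sub>C x"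
    and scaleC_of_real: "complex_of_real r *\<^sub>C x = r *\<^sub>R x"
    and mult_scaleC_left: "(z *\<^sub>C x) * y = z *\<^sub>C (x * y)"
    and mult_scaleC_right: "x * (z *\<^sub>C y) = z *\<^sub>C (x * y)"
    and norm_scaleC: "norm (z *\<^sub>C x) = cmod z * norm x"
    and star_star: "star (star x) = x"
    and star_add: "star (x + y) = star x + star y"
    and star_scaleC: "star (z *\<^sub>C x) = cnj z *\<^sub>C star x"
    and star_mult: "star (x * y) = star y * star x"
    and norm_star_mult_self: "norm (star x * x) = (norm x)\<^sup>2"

class comm_cstar_algebra = cstar_algebra + comm_ring_1

instantiation complex :: comm_cstar_algebra
begin

definition scaleC_complex :: "complex \<Rightarrow> complex \<Rightarrow> complex" where
  "scaleC_complex z w = z * w"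

definition star_complex :: "complex \<Rightarrow> complex" where
  "star_complex z = cnj z"

instance
  by standard
    (auto simp: scaleC_complex_def star_complex_def algebra_simps norm_mult power2_eq_square
      scaleR_conv_of_real)

end

definition cstar_spectrum :: "'a::cstar_algebra \<Rightarrow> complex set" where
  "cstar_spectrum a = {z. \<not> (\<exists>b. (z *\<^sub>C 1 - a) * b = 1 \<and> b * (z *\<^sub>C 1 - a) = 1)}"

text \<open>The relation a \<ge> 0 in the algebra.\<close>

definition cstar_nonneg :: "'a::cstar_algebra \<Rightarrow> bool" where
  "cstar_nonneg a \<longleftrightarrow> star a = a \<and> cstar_spectrum a \<subseteq> complex_of_real ` {0..}"

definition mat_star :: "'a::cstar_algebra mat \<Rightarrow> 'a mat" where
  "mat_star A = mat (dim_col A) (dim_row A) (\<lambda>(j, k). star (A $$ (k, j)))"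

definition vec_cinner :: "'a::cstar_algebra vec \<Rightarrow> 'a vec \<Rightarrow> 'a" where
  "vec_cinner x y = (\<Sum>j<dim_vec y. x $ j * star (y $ j))"

definition mat_positive :: "nat \<Rightarrow> 'a::cstar_algebra mat \<Rightarrow> bool" where
  "mat_positive n A \<longleftrightarrow>
     A \<in> carrier_mat n n \<and> mat_star A = A \<and>
     (\<forall>x \<in> carrier_vec n. cstar_nonneg (vec_cinner (A *\<^sub>v x) x))"

definition schur_product :: "'a::cstar_algebra mat \<Rightarrow> 'a mat \<Rightarrow> 'a mat" where
  "schur_product A B =
     mat (dim_row A) (dim_col A)
       (\<lambda>(j, k). (1 / 2) *\<^sub>R (A $$ (j, k) * B $$ (j, k) + B $$ (j, k) * A $$ (j, k)))"

end

theory Submission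
  imports Defs "HOL-Analysis.Complex_Transcendental" "HOL-Library.Complex_Order"
begin

text \<open>
  Positivity in a commutative C*-algebra can be tested on characters, that is, on unital
  multiplicative linear functionals: the spectrum of an element is exactly the set of values that
  characters take on it (\<open>character_in_spectrum\<close> and \<open>spectrum_value_attained\<close>), and characters
  respect the involution (\<open>character_star\<close>). Applied to \<open>\<langle>A x, x\<rangle>\<close> this says that a Hermitian
  matrix \<open>A\<close> over the algebra is positive iff every character maps it, entry by entry, to a positive
  semidefinite complex matrix (\<open>mat_positive_iff_characters\<close>). Characters are multiplicative and the
  algebra is commutative, so they turn the Schur product into the entrywise product of complex
  matrices. The theorem thus reduces to the classical Schur product theorem
  (\<open>complex_schur_product\<close>): write one factor as a sum of rank one matrices \<open>v v\<^sup>*\<close>; then the form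
  of the product is a sum of values of the form of the other factor.

  The analytic core is that a spectral value is attained by a character. If \<open>z - a\<close> is not
  invertible, then it lies in a maximal ideal \<open>I\<close>, and the character is the quotient map modulo \<open>I\<close>,
  provided that every element is congruent to a scalar modulo \<open>I\<close>. This is the Gelfand-Mazur
  theorem for the field \<open>A / I\<close>. It is proved here for the algebra itself, equipped with the
  quotient seminorm \<open>x \<mapsto> infdist x I\<close>, where "equal modulo \<open>I\<close>" is weakened to "at distance zero".

  The nonemptiness of the spectrum (\<open>spectrum_nonempty\<close>) follows Rickart's elementary argument, which
  replaces Liouville's theorem by averages over roots of unity. Suppose that \<open>1 - w a\<close> has an inverse
  \<open>R w\<close> for every complex \<open>w\<close>. For \<open>\<omega> = exp (2 \<pi> \<i> / n)\<close>, the mean over \<open>k < n\<close> of \<open>R (s \<omega>\<^sup>k)\<close> is the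
  inverse of \<open>1 - (s a)\<^sup>n\<close>. This mean is close to 1 exactly when \<open>(s a)\<^sup>n\<close> is small, and it
  depends on \<open>s\<close> uniformly continuously, with a modulus of continuity independent of \<open>n\<close>. Hence the
  property that some power of \<open>s a\<close> has seminorm below 1 propagates from \<open>s = 0\<close> in steps of a fixed
  length to all \<open>s \<ge> 0\<close>. For large \<open>s\<close> this contradicts the invertibility of \<open>a\<close>.
\<close>

section \<open>Complex scalars inside the algebra\<close>

abbreviation cscalar :: "complex \<Rightarrow> 'a::cstar_algebra" where
  "cscalar z \<equiv> z *\<^sub>C 1"

lemma cscalar_of_real: "cscalar (complex_of_real r) = (of_real r :: 'a::cstar_algebra)"
  unfolding scaleC_of_real by (simp add: of_real_def)

lemma cscalar_0 [simp]: "cscalar 0 = (0 :: 'a::cstar_algebra)"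
  using cscalar_of_real[of 0] by simp

lemma cscalar_1 [simp]: "cscalar 1 = (1 :: 'a::cstar_algebra)"
  using cscalar_of_real[of 1] by simp

lemma cscalar_mult: "cscalar (z * w) = (cscalar z * cscalar w :: 'a::cstar_algebra)"
  by (simp add: mult_scaleC_left scaleC_scaleC)

lemma cscalar_diff: "cscalar (z - w) = (cscalar z - cscalar w :: 'a::cstar_algebra)"
  using scaleC_add_left[of "z - w" w "1::'a"] by (simp add: algebra_simps)

lemma cscalar_minus: "cscalar (- z) = (- cscalar z :: 'a::cstar_algebra)"
  using cscalar_diff[of 0 z] by simp

lemma cscalar_sum: "cscalar (\<Sum>i\<in>I. f i) = (\<Sum>i\<in>I. cscalar (f i) :: 'a::cstar_algebra)"
  by (induction I rule: infinite_finite_induct) (auto simp: scaleC_add_left)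

lemma cscalar_power: "cscalar (z ^ k) = (cscalar z ^ k :: 'a::cstar_algebra)"
  by (induction k) (auto simp: cscalar_mult)

lemma norm_cscalar [simp]: "norm (cscalar z :: 'a::cstar_algebra) = cmod z"
  by (simp add: norm_scaleC)

lemma star_1 [simp]: "star 1 = (1 :: 'a::cstar_algebra)"
  by (metis mult_1 mult_1_right star_mult star_star)

lemma star_0 [simp]: "star 0 = (0 :: 'a::cstar_algebra)"
  by (metis add_cancel_right_right star_add)

lemma star_diff: "star (x - y) = star x - star (y :: 'a::cstar_algebra)"
  using star_add[of "x - y" y] by (simp add: eq_diff_eq)

lemma star_cscalar: "star (cscalar z) = (cscalar (cnj z) :: 'a::cstar_algebra)"
  by (simp add: star_scaleC)

lemma star_sum: "star (\<Sum>i\<in>I. f i) = (\<Sum>i\<in>I. star (f i) :: 'a::cstar_algebra)"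
  by (induction I rule: infinite_finite_induct) (auto simp: star_add)

lemma invertible_near_one:
  fixes x :: "'a::cstar_algebra"
  assumes "norm x < 1"
  shows "\<exists>s. (1 - x) * s = 1"
proof -
  have sm: "summable (\<lambda>k. x ^ k)"
    by (rule summable_comparison_test'[of "\<lambda>k. norm x ^ k" 0])
      (use assms in \<open>auto simp: summable_geometric norm_power_ineq\<close>)
  have "x * (\<Sum>k. x ^ k) = (\<Sum>k. x ^ k) - 1"
    using suminf_mult[OF sm, of x] suminf_split_head[OF sm] by simp
  then show ?thesis
    by (intro exI[of _ "\<Sum>k. x ^ k"]) (simp add: algebra_simps)
qed

section \<open>Nonempty spectra for submultiplicative seminorms\<close>

lemma cis_root_of_unity: "0 < n \<Longrightarrow> cis (2 * pi / real n) ^ n = 1"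
  unfolding Complex.DeMoivre by simp

lemma sum_powers_root_of_unity:
  assumes "0 < n" "j < n"
  shows "(\<Sum>k<n. (cis (2 * pi / n) ^ k) ^ j) = (if j = 0 then of_nat n else 0)"
proof (cases "j = 0")
  case False
  define \<omega> where "\<omega> = cis (2 * pi / n) ^ j"
  have eq: "exp (2 * of_real pi * \<i> * of_nat j / of_nat n) = \<omega>"
    unfolding \<omega>_def Complex.DeMoivre unfolding cis_conv_exp by (simp add: mult_ac)
  have "\<omega> \<noteq> 1"
    using complex_root_unity_eq_1[of n j] assms False nat_dvd_not_less unfolding eq by auto
  moreover have "\<omega> ^ n = 1"
    unfolding \<omega>_def power_mult[symmetric] mult.commute[of j n]
    by (simp only: power_mult cis_root_of_unity[OF assms(1)] power_one)
  ultimately have "(\<Sum>k<n. \<omega> ^ k) = 0" by (simp add: geometric_sum)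
  then show ?thesis using False
    by (simp add: \<omega>_def power_mult[symmetric] mult.commute)
qed auto

text \<open>
  The quotient seminorm of an ideal has these properties, and they suffice for the
  spectral theory below. Elements at seminorm zero play the role of zero, so "\<open>b\<close> is an inverse of
  \<open>x\<close>" reads \<open>q (x * b - 1) = 0\<close>; no quotient algebra has to be formed.
\<close>

locale submultiplicative_seminorm =
  fixes q :: "'a::comm_cstar_algebra \<Rightarrow> real"
  assumes triangle: "q (x + y) \<le> q x + q y"
    and submult: "q (x * y) \<le> q x * q y"
    and le_norm: "q x \<le> norm x"
    and nonneg: "0 \<le> q x"
    and one: "1 \<le> q 1"
begin

lemma zero [simp]: "q 0 = 0"
  using le_norm[of 0] nonneg[of 0] by simp

lemma cscalar_le: "q (cscalar z * x) \<le> cmod z * q x"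
  using submult[of "cscalar z" x] mult_right_mono[OF le_norm[of "cscalar z"] nonneg[of x]]
  by simp

lemma minus [simp]: "q (- x) = q x"
  using cscalar_le[of "-1" x] cscalar_le[of "-1" "- x"] by (simp add: cscalar_minus)

lemma triangle_diff: "q (x - y) \<le> q x + q y"
  using triangle[of x "- y"] by simp

lemma diff_commute: "q (x - y) = q (y - x)"
  using minus[of "x - y"] by simp

lemma le_add_diff: "q x \<le> q y + q (x - y)"
  using triangle[of y "x - y"] by simp

lemma null_mult: "q x = 0 \<Longrightarrow> q (x * y) = 0"
  using submult[of x y] nonneg[of "x * y"] by simp

lemma null_add: "q x = 0 \<Longrightarrow> q y = 0 \<Longrightarrow> q (x + y) = 0"
  using triangle[of x y] nonneg[of "x + y"] by simp

lemma null_sum: "(\<And>i. i \<in> I \<Longrightarrow> q (f i) = 0) \<Longrightarrow> q (\<Sum>i\<in>I. f i) = 0"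
  by (induction I rule: infinite_finite_induct) (auto intro: null_add)

lemma sum_le: "q (\<Sum>i\<in>I. f i) \<le> (\<Sum>i\<in>I. q (f i))"
proof (induction I rule: infinite_finite_induct)
  case (insert i I)
  then show ?case using triangle[of "f i" "\<Sum>i\<in>I. f i"] by simp
qed auto

lemma congruent: "q (x - y) = 0 \<Longrightarrow> q x = q y"
  using le_add_diff[of x y] le_add_diff[of y x] diff_commute[of x y] by simp

lemma power_le: "q (x ^ Suc k) \<le> q x ^ Suc k"
proof (induction k)
  case (Suc k)
  have "q (x ^ Suc (Suc k)) \<le> q x * q (x ^ Suc k)"
    using submult[of x "x ^ Suc k"] by simp
  also have "\<dots> \<le> q x * q x ^ Suc k"
    using Suc nonneg by (rule mult_left_mono)
  finally show ?case by simp
qed simp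

text \<open>
  The next two estimates compare \<open>x\<close> with an inverse \<open>F\<close> of \<open>1 - x\<close> in both directions: \<open>F\<close> is close
  to 1 iff \<open>x\<close> is small. They pass from a small power of \<open>s a\<close> to a resolvent mean, and back.
\<close>

lemma inverse_close_to_one:
  assumes F: "q (F * (1 - x) - 1) = 0" and x: "q x < 1"
  shows "q (F - 1) \<le> q x / (1 - q x)"
proof -
  have "F - 1 = (F * (1 - x) - 1) + ((F - 1) * x + x)"
    by (simp add: algebra_simps)
  from arg_cong[OF this, of q] have "q (F - 1) \<le> q ((F - 1) * x + x)"
    using triangle[of "F * (1 - x) - 1" "(F - 1) * x + x"] F by linarith
  also have "\<dots> \<le> q (F - 1) * q x + q x"
    using triangle[of "(F - 1) * x" x] submult[of "F - 1" x] by simp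
  finally show ?thesis using x by (simp add: field_simps)
qed

lemma close_to_zero_if_inverse_close_to_one:
  assumes F: "q (F * (1 - y) - 1) = 0" and e: "q (F - 1) \<le> e" "e < 1"
  shows "q y \<le> e / (1 - e)"
proof -
  have "y = ((F - 1) - y * (F - 1)) - (F * (1 - y) - 1)"
    by (simp add: algebra_simps)
  from arg_cong[OF this, of q] have "q y \<le> q ((F - 1) - y * (F - 1))"
    using triangle_diff[of "(F - 1) - y * (F - 1)" "F * (1 - y) - 1"] F by linarith
  also have "\<dots> \<le> q (F - 1) + q y * q (F - 1)"
    using triangle_diff[of "F - 1" "y * (F - 1)"] submult[of y "F - 1"] by simp
  also have "\<dots> \<le> e + q y * e"
    using e nonneg[of y] by (intro add_mono mult_left_mono) auto
  finally show ?thesis using e by (simp add: field_simps)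
qed

text \<open>The resolvent identity \<open>R w - R w' = (w - w') a R w R w'\<close>, up to seminorm zero.\<close>

lemma resolvent_difference:
  assumes R: "\<And>w. q (R w * (1 - cscalar w * a) - 1) = 0"
  shows "q (R w - R w') \<le> cmod (w - w') * q a * q (R w) * q (R w')"
proof -
  let ?E = "\<lambda>w. R w * (1 - cscalar w * a) - 1"
  have "R w - R w' - cscalar (w - w') * (a * R w * R w') = ?E w * R w' + ?E w' * (- R w)"
    by (simp add: algebra_simps cscalar_diff)
  then have "q (R w - R w') = q (cscalar (w - w') * (a * R w * R w'))"
    using R null_add null_mult by (intro congruent) metis
  also have "\<dots> \<le> cmod (w - w') * q (a * R w * R w')"
    by (rule cscalar_le)
  also have "\<dots> \<le> cmod (w - w') * (q a * q (R w) * q (R w'))"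
    using submult[of "a * R w" "R w'"] mult_right_mono[OF submult[of a "R w"] nonneg[of "R w'"]]
    by (intro mult_left_mono) auto
  finally show ?thesis by (simp add: mult.assoc)
qed

lemma resolvent_pos:
  assumes R: "\<And>w. q (R w * (1 - cscalar w * a) - 1) = 0"
  shows "0 < q (R w)"
proof (rule ccontr)
  assume "\<not> 0 < q (R w)"
  then have "q (R w) = 0" using nonneg[of "R w"] by simp
  then have "q 1 = 0"
    using congruent[OF R[of w]] null_mult by metis
  then show False using one by simp
qed

text \<open>
  By the resolvent identity, a bound for \<open>q (R w)\<close> on a disc gives a Lipschitz constant there.
  The same identity makes \<open>1 / q (R w)\<close> Lipschitz on the whole plane; being positive,
  it is bounded away from zero on the compact disc, which is the bound in question.
\<close>

lemma resolvent_uniformly_continuous: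
  assumes R: "\<And>w. q (R w * (1 - cscalar w * a) - 1) = 0" and e: "0 < e"
  obtains d where "0 < d"
    "\<And>w w'. cmod w \<le> s \<Longrightarrow> cmod w' \<le> s \<Longrightarrow> cmod (w - w') \<le> d \<Longrightarrow> q (R w - R w') \<le> e"
proof -
  note pos = resolvent_pos[of R a, OF R]
  have lip: "\<bar>inverse (q (R w)) - inverse (q (R w'))\<bar> \<le> q a * dist w w'" for w w'
  proof -
    have "\<bar>q (R w) - q (R w')\<bar> \<le> q (R w - R w')"
      using le_add_diff[of "R w" "R w'"] le_add_diff[of "R w'" "R w"] diff_commute[of "R w'" "R w"]
      by linarith
    also note resolvent_difference[of R a, OF R]
    finally have "\<bar>q (R w) - q (R w')\<bar> \<le> (q a * dist w w') * (q (R w) * q (R w'))"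
      by (simp add: mult_ac dist_norm)
    moreover have "\<bar>inverse (q (R w)) - inverse (q (R w'))\<bar> =
        \<bar>q (R w) - q (R w')\<bar> / (q (R w) * q (R w'))"
      using pos[of w] pos[of w'] by (simp add: inverse_diff_inverse abs_mult divide_simps)
    ultimately show ?thesis
      using pos[of w] pos[of w'] by (simp add: divide_le_eq)
  qed
  have cont: "continuous_on (cball 0 s) (\<lambda>w. inverse (q (R w)))"
    unfolding continuous_on_iff dist_real_def
  proof (intro ballI allI impI)
    fix w \<epsilon> :: real and x assume "0 < \<epsilon>"
    have "\<bar>inverse (q (R x')) - inverse (q (R x))\<bar> < \<epsilon>" if "dist x' x < \<epsilon> / (q a + 1)" for x'
    proof -
      have "q a * dist x' x \<le> (q a + 1) * dist x' x"
        using nonneg[of a] by (intro mult_right_mono) auto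
      also have "\<dots> < \<epsilon>"
        using that nonneg[of a] by (simp add: field_simps)
      finally show ?thesis using lip[of x' x] by linarith
    qed
    then show "\<exists>d>0. \<forall>x'\<in>cball 0 s. dist x' x < d \<longrightarrow>
        \<bar>inverse (q (R x')) - inverse (q (R x))\<bar> < \<epsilon>"
      using \<open>0 < \<epsilon>\<close> nonneg[of a] by (intro exI[of _ "\<epsilon> / (q a + 1)"]) auto
  qed
  have "\<exists>B>0. \<forall>w\<in>cball 0 s. q (R w) \<le> B"
  proof (cases "cball (0::complex) s = {}")
    case False
    then obtain w0 where "\<forall>w\<in>cball 0 s. inverse (q (R w0)) \<le> inverse (q (R w))"
      using continuous_attains_inf[OF compact_cball False cont] by blast
    then show ?thesis using pos by (intro exI[of _ "q (R w0)"]) simp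
  next
    case True
    then show ?thesis by (intro exI[of _ 1]) simp
  qed
  then obtain B where B: "0 < B" "\<And>w. cmod w \<le> s \<Longrightarrow> q (R w) \<le> B" by auto
  let ?d = "e / ((q a + 1) * B * B)"
  show ?thesis
  proof
    show "0 < ?d" using e B nonneg[of a] by simp
    fix w w' assume w: "cmod w \<le> s" "cmod w' \<le> s" "cmod (w - w') \<le> ?d"
    have "q (R w - R w') \<le> cmod (w - w') * q a * q (R w) * q (R w')"
      by (rule resolvent_difference[of R a, OF R])
    also have "\<dots> \<le> ?d * (q a + 1) * B * B"
      using w B e nonneg by (intro mult_mono) auto
    also have "\<dots> = ?d * ((q a + 1) * B * B)" by (simp only: mult.assoc)
    also have "\<dots> = e" using B(1) nonneg[of a] by simp
    finally show "q (R w - R w') \<le> e" .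
  qed
qed

definition resolvent_mean :: "(complex \<Rightarrow> 'a) \<Rightarrow> nat \<Rightarrow> real \<Rightarrow> 'a" where
  "resolvent_mean R n s =
     cscalar (1 / of_nat n) * (\<Sum>k<n. R (complex_of_real s * cis (2 * pi / n) ^ k))"

text \<open>
  With \<open>x = s a\<close> and \<open>\<omega>\<close> the primitive root, \<open>1 - x\<^sup>n = 1 - (\<omega>\<^sup>k x)\<^sup>n\<close> is divisible by
  \<open>1 - \<omega>\<^sup>k x\<close> with a geometric sum as quotient. So \<open>1 - x\<^sup>n\<close> times \<open>R (s \<omega>\<^sup>k)\<close> is this geometric
  sum, and summing over \<open>k\<close> leaves only its constant terms.
\<close>

lemma resolvent_mean_inverse:
  assumes R: "\<And>w. q (R w * (1 - cscalar w * a) - 1) = 0" and n: "0 < n"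
  shows "q (resolvent_mean R n s * (1 - (cscalar (complex_of_real s) * a) ^ n) - 1) = 0"
proof -
  define \<omega> where "\<omega> k = cis (2 * pi / n) ^ k" for k
  define x :: 'a where "x = cscalar (complex_of_real s) * a"
  define w where "w k = complex_of_real s * \<omega> k" for k
  have wx: "cscalar (w k) * a = cscalar (\<omega> k) * x" for k
    by (simp add: w_def x_def cscalar_mult mult_ac)
  have "\<omega> k ^ n = 1" for k
    unfolding \<omega>_def power_mult[symmetric] mult.commute[of k n]
    by (simp only: power_mult cis_root_of_unity[OF n] power_one)
  then have geo: "1 - x ^ n = (1 - cscalar (w k) * a) * (\<Sum>j<n. (cscalar (\<omega> k) * x) ^ j)" for k
    using one_diff_power_eq[of "cscalar (\<omega> k) * x" n]
    by (simp add: wx power_mult_distrib cscalar_power[symmetric])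
  have "(\<Sum>k<n. \<Sum>j<n. (cscalar (\<omega> k) * x) ^ j) = (\<Sum>j<n. \<Sum>k<n. (cscalar (\<omega> k) * x) ^ j)"
    by (rule sum.swap)
  also have "\<dots> = (\<Sum>j<n. cscalar (\<Sum>k<n. \<omega> k ^ j) * x ^ j)"
    by (simp add: power_mult_distrib cscalar_power cscalar_sum sum_distrib_right)
  also have "\<dots> = (\<Sum>j<n. if j = 0 then cscalar (of_nat n) else 0)"
    using n by (intro sum.cong) (auto simp: \<omega>_def sum_powers_root_of_unity)
  also have "\<dots> = cscalar (of_nat n)"
    using n by (simp add: sum.delta)
  finally have total: "(\<Sum>k<n. \<Sum>j<n. (cscalar (\<omega> k) * x) ^ j) = cscalar (of_nat n)" .
  have split: "R (w k) * (1 - x ^ n) - (\<Sum>j<n. (cscalar (\<omega> k) * x) ^ j) =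
      (R (w k) * (1 - cscalar (w k) * a) - 1) * (\<Sum>j<n. (cscalar (\<omega> k) * x) ^ j)" for k
    unfolding geo[of k] by (simp add: algebra_simps)
  have "(\<Sum>k<n. R (w k)) * (1 - x ^ n) - cscalar (of_nat n) =
      (\<Sum>k<n. (R (w k) * (1 - cscalar (w k) * a) - 1) * (\<Sum>j<n. (cscalar (\<omega> k) * x) ^ j))"
    unfolding total[symmetric] sum_distrib_right sum_subtractf[symmetric]
    by (intro sum.cong refl split)
  then have "q ((\<Sum>k<n. R (w k)) * (1 - x ^ n) - cscalar (of_nat n)) = 0"
    using R by (auto intro!: null_sum null_mult)
  moreover have "cscalar (1 / of_nat n) * cscalar (of_nat n) = (1::'a)"
    using n by (simp add: cscalar_mult[symmetric])
  then have "resolvent_mean R n s * (1 - x ^ n) - 1 =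
      ((\<Sum>k<n. R (w k)) * (1 - x ^ n) - cscalar (of_nat n)) * cscalar (1 / of_nat n)"
    by (simp add: resolvent_mean_def w_def \<omega>_def algebra_simps)
  ultimately show ?thesis using null_mult by (simp add: x_def)
qed

lemma resolvent_mean_diff:
  assumes n: "0 < n"
    and d: "\<And>k. q (R (complex_of_real s * cis (2 * pi / n) ^ k)
                  - R (complex_of_real t * cis (2 * pi / n) ^ k)) \<le> e"
  shows "q (resolvent_mean R n s - resolvent_mean R n t) \<le> e"
proof -
  let ?f = "\<lambda>k. R (complex_of_real s * cis (2 * pi / n) ^ k)
                  - R (complex_of_real t * cis (2 * pi / n) ^ k)"
  have "resolvent_mean R n s - resolvent_mean R n t = cscalar (1 / of_nat n) * (\<Sum>k<n. ?f k)"
    by (simp add: resolvent_mean_def sum_subtractf algebra_simps)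
  also have "q \<dots> \<le> cmod (1 / of_nat n) * q (\<Sum>k<n. ?f k)"
    by (rule cscalar_le)
  also have "\<dots> \<le> cmod (1 / of_nat n) * (\<Sum>k<n. e)"
    using sum_le[of ?f "{..<n}"] sum_mono[of "{..<n}" "\<lambda>k. q (?f k)" "\<lambda>_. e"] d
    by (intro mult_left_mono) (auto intro: order.trans)
  also have "\<dots> = e" using n by (simp add: norm_divide)
  finally show ?thesis .
qed

text \<open>
  The tolerance 1/3 in the modulus of continuity is chosen so that the propagated mean stays within
  a distance less than 1/2 of 1: this is what makes the resulting bound \<open>e / (1 - e)\<close> for the power
  smaller than 1. Raising the given power further makes it less than 1/10, so the mean at \<open>s\<close> is within
  1/9 of 1 and the mean at \<open>t\<close> within 1/9 + 1/3 = 4/9.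
\<close>

lemma topologically_nilpotent_step:
  assumes R: "\<And>w. q (R w * (1 - cscalar w * a) - 1) = 0"
    and d: "\<And>w w'. cmod w \<le> r \<Longrightarrow> cmod w' \<le> r \<Longrightarrow> cmod (w - w') \<le> d \<Longrightarrow> q (R w - R w') \<le> 1/3"
    and s: "\<bar>s\<bar> \<le> r" "\<bar>t\<bar> \<le> r" "\<bar>t - s\<bar> \<le> d"
    and m: "0 < m" "q ((cscalar (complex_of_real s) * a) ^ m) < 1"
  shows "\<exists>n>0. q ((cscalar (complex_of_real t) * a) ^ n) < 1"
proof -
  define x :: 'a where "x = cscalar (complex_of_real s) * a"
  obtain k where k: "q (x ^ m) ^ k < 1/10"
    using real_arch_pow_inv[of "1/10" "q (x ^ m)"] m x_def by auto
  define n where "n = m * Suc k"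
  have n: "0 < n" using m by (simp add: n_def)
  have "q (x ^ n) \<le> q (x ^ m) ^ Suc k"
    unfolding n_def power_mult by (rule power_le)
  also have "\<dots> \<le> q (x ^ m) ^ k"
    using m nonneg[of "x ^ m"] by (intro power_decreasing) (auto simp: x_def)
  finally have xn: "q (x ^ n) < 1/10" using k by simp
  have "q (resolvent_mean R n s - 1) \<le> q (x ^ n) / (1 - q (x ^ n))"
    using xn resolvent_mean_inverse[of R a, OF R n, of s]
    by (intro inverse_close_to_one) (auto simp: x_def)
  also have "\<dots> \<le> 1/9" using xn by (simp add: field_simps)
  finally have close_s: "q (resolvent_mean R n s - 1) \<le> 1/9" .
  have "q (resolvent_mean R n t - resolvent_mean R n s) \<le> 1/3"
  proof (rule resolvent_mean_diff[OF n], rule d)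
    fix k
    have "complex_of_real t * cis (2 * pi / n) ^ k - complex_of_real s * cis (2 * pi / n) ^ k =
        complex_of_real (t - s) * cis (2 * pi / n) ^ k"
      by (simp add: algebra_simps)
    then show "cmod (complex_of_real t * cis (2 * pi / n) ^ k
        - complex_of_real s * cis (2 * pi / n) ^ k) \<le> d"
      using s(3) by (simp only: norm_mult norm_power norm_cis norm_of_real power_one mult_1_right)
  qed (use s in \<open>auto simp: norm_mult norm_power\<close>)
  then have "q (resolvent_mean R n t - 1) \<le> 4/9"
    using close_s triangle[of "resolvent_mean R n t - resolvent_mean R n s" "resolvent_mean R n s - 1"]
    by simp
  then have "q ((cscalar (complex_of_real t) * a) ^ n) \<le> (4/9) / (1 - 4/9)"
    by (intro close_to_zero_if_inverse_close_to_one[OF resolvent_mean_inverse[of R a, OF R n]]) auto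
  then show ?thesis using n by (intro exI[of _ n]) auto
qed

lemma topologically_nilpotent_if_empty_spectrum:
  assumes R: "\<And>w. q (R w * (1 - cscalar w * a) - 1) = 0" and r: "0 \<le> r"
  shows "\<exists>n>0. q ((cscalar (complex_of_real r) * a) ^ n) < 1"
proof -
  obtain d where d: "0 < d"
    "\<And>w w'. cmod w \<le> r \<Longrightarrow> cmod w' \<le> r \<Longrightarrow> cmod (w - w') \<le> d \<Longrightarrow> q (R w - R w') \<le> 1/3"
    using resolvent_uniformly_continuous[of R a "1/3" r, OF R] by auto
  obtain N :: nat where N: "r / d < real N" using reals_Archimedean2 by blast
  then have N0: "0 < N" using r d(1) by (cases N) (auto simp: field_simps)
  have "\<exists>n>0. q ((cscalar (complex_of_real (real k * (r / N))) * a) ^ n) < 1" if "k \<le> N" for k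
    using that
  proof (induction k)
    case 0
    show ?case by (intro exI[of _ 1]) simp
  next
    case (Suc k)
    have bd: "\<bar>real i * (r / N)\<bar> \<le> r" if "i \<le> N" for i
      using that r N0 mult_right_mono[of "real i" "real N" r] by (simp add: field_simps)
    have "\<bar>real (Suc k) * (r / N) - real k * (r / N)\<bar> \<le> d"
      using N N0 r d(1) by (simp add: algebra_simps add_divide_distrib) (simp add: field_simps)
    moreover obtain m where "0 < m" "q ((cscalar (complex_of_real (real k * (r / N))) * a) ^ m) < 1"
      using Suc by auto
    ultimately show ?case
      using Suc.prems bd[of k] bd[of "Suc k"] by (intro topologically_nilpotent_step[OF R d(2)]) auto
  qed
  from this[of N] show ?thesis using N0 by simp
qed

text \<open>
  If every \<open>z - a\<close> had an inverse \<open>b z\<close>, then so would every \<open>1 - w a\<close>, and the preceding lemma would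
  make some power of \<open>r a\<close> smaller than 1 for each \<open>r \<ge> 0\<close>. The choice of \<open>r\<close> above the
  seminorm of an inverse \<open>c\<close> of \<open>a\<close> is contradictory, since \<open>1 = (c / r)\<^sup>n (r a)\<^sup>n\<close> modulo
  seminorm zero.
\<close>

theorem spectrum_nonempty: "\<exists>z. \<forall>b. q ((cscalar z - a) * b - 1) \<noteq> 0"
proof (rule ccontr)
  assume "\<not> ?thesis"
  then obtain b where b: "\<And>z. q ((cscalar z - a) * b z - 1) = 0" by metis
  define R where "R w = (if w = 0 then 1 else cscalar (1 / w) * b (1 / w))" for w
  have R: "q (R w * (1 - cscalar w * a) - 1) = 0" for w
  proof (cases "w = 0")
    case False
    then have "cscalar (1 / w) * cscalar w = (1::'a)" by (simp add: cscalar_mult[symmetric])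
    then have "R w * (1 - cscalar w * a) = (cscalar (1 / w) - a) * b (1 / w)"
      using False by (simp add: R_def algebra_simps)
    then show ?thesis using b[of "1 / w"] by simp
  qed (simp add: R_def)
  define c where "c = - b 0"
  have c: "q (c * a - 1) = 0" using b[of 0] by (simp add: c_def mult_ac)
  define r where "r = q c + 1"
  have r: "0 < r" "q c \<le> r" using nonneg[of c] by (auto simp: r_def)
  obtain n where n: "0 < n" "q ((cscalar (complex_of_real r) * a) ^ n) < 1"
    using topologically_nilpotent_if_empty_spectrum[of R a r, OF R] r by auto
  define c' :: 'a where "c' = cscalar (1 / complex_of_real r) * c"
  have "q c' \<le> cmod (1 / complex_of_real r) * q c"
    unfolding c'_def by (rule cscalar_le)
  also have "\<dots> \<le> 1" using r by (simp add: norm_divide)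
  finally have c'1: "q c' \<le> 1" .
  have "q (c' ^ n) \<le> q c' ^ n" using power_le[of c' "n - 1"] n by simp
  also have "\<dots> \<le> 1" using c'1 nonneg by (simp add: power_le_one)
  finally have c'n: "q (c' ^ n) \<le> 1" .
  have "cscalar (1 / complex_of_real r) * cscalar (complex_of_real r) = (1::'a)"
    using r by (simp add: cscalar_mult[symmetric])
  then have "c' * (cscalar (complex_of_real r) * a) = c * a"
    unfolding c'_def by (metis mult.assoc mult.commute mult_1)
  then have "(c * a) ^ n = c' ^ n * (cscalar (complex_of_real r) * a) ^ n"
    by (metis power_mult_distrib)
  then have "q ((c * a) ^ n) \<le> q (c' ^ n) * q ((cscalar (complex_of_real r) * a) ^ n)"
    using submult by simp
  also have "\<dots> \<le> 1 * q ((cscalar (complex_of_real r) * a) ^ n)"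
    using c'n nonneg by (rule mult_right_mono)
  also have "\<dots> < 1" using n by simp
  finally have "q ((c * a) ^ n) < 1" .
  moreover have "q ((c * a) ^ n - 1) = 0"
    unfolding power_diff_1_eq by (rule null_mult[OF c])
  then have "q ((c * a) ^ n) = q 1" by (rule congruent)
  ultimately show False using one by simp
qed

end

section \<open>Maximal ideals and characters\<close>

definition ring_ideal :: "'a::comm_ring_1 set \<Rightarrow> bool" where
  "ring_ideal I \<longleftrightarrow> 0 \<in> I \<and> (\<forall>x\<in>I. \<forall>y\<in>I. x + y \<in> I) \<and> (\<forall>x\<in>I. \<forall>r. x * r \<in> I)"

lemma ring_ideal_zero: "ring_ideal I \<Longrightarrow> 0 \<in> I"
  and ring_ideal_add: "ring_ideal I \<Longrightarrow> x \<in> I \<Longrightarrow> y \<in> I \<Longrightarrow> x + y \<in> I"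
  and ring_ideal_mult: "ring_ideal I \<Longrightarrow> x \<in> I \<Longrightarrow> x * r \<in> I"
  by (auto simp: ring_ideal_def)

lemma ring_ideal_minus: "ring_ideal I \<Longrightarrow> x \<in> I \<Longrightarrow> - x \<in> I"
  using ring_ideal_mult[of I x "-1"] by simp

lemma ring_ideal_diff: "ring_ideal I \<Longrightarrow> x \<in> I \<Longrightarrow> y \<in> I \<Longrightarrow> x - y \<in> I"
  using ring_ideal_add[of I x "- y"] ring_ideal_minus[of I y] by simp

text \<open>
  Maximality enters through its consequence that elements outside the ideal are invertible modulo it.
\<close>

lemma maximal_ideal_exists:
  fixes c :: "'a::comm_ring_1"
  assumes c: "\<nexists>b. c * b = 1"
  obtains I where "ring_ideal I" "c \<in> I" "1 \<notin> I"
    "\<And>d. d \<notin> I \<Longrightarrow> \<exists>b. d * b - 1 \<in> I"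
proof -
  define P where "P = {I. ring_ideal I \<and> c \<in> I \<and> 1 \<notin> I}"
  have "range ((*) c) \<in> P"
  proof -
    have "c * x + c * y \<in> range ((*) c)" for x y
      using rangeI[of "(*) c" "x + y"] by (simp add: distrib_left)
    moreover have "c * x * y \<in> range ((*) c)" for x y
      using rangeI[of "(*) c" "x * y"] by (simp add: mult.assoc)
    moreover have "0 \<in> range ((*) c)" "c \<in> range ((*) c)"
      using rangeI[of "(*) c" 0] rangeI[of "(*) c" 1] by simp_all
    moreover have "1 \<notin> range ((*) c)"
      using c by (auto dest: sym)
    ultimately show ?thesis unfolding P_def ring_ideal_def by blast
  qed
  then have "P \<noteq> {}" by blast
  moreover have "\<Union>C \<in> P" if "C \<noteq> {}" and ch: "subset.chain P C" for C
  proof -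
    have C: "C \<subseteq> P" "\<And>X Y. X \<in> C \<Longrightarrow> Y \<in> C \<Longrightarrow> X \<subseteq> Y \<or> Y \<subseteq> X"
      using ch by (auto simp: subset_chain_def)
    have "x + y \<in> \<Union>C" if "x \<in> \<Union>C" "y \<in> \<Union>C" for x y
    proof -
      from that obtain X Y where "x \<in> X" "X \<in> C" "y \<in> Y" "Y \<in> C" by blast
      then obtain Z where "x \<in> Z" "y \<in> Z" "Z \<in> C" using C(2) by blast
      moreover from this have "ring_ideal Z" using C(1) by (auto simp: P_def)
      ultimately show ?thesis using ring_ideal_add[of Z x y] by blast
    qed
    moreover have "x * r \<in> \<Union>C" if "x \<in> \<Union>C" for x r
    proof -
      from that obtain X where X: "x \<in> X" "X \<in> C" by blast
      then have "ring_ideal X" using C(1) by (auto simp: P_def)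
      then show ?thesis using X ring_ideal_mult[of X x r] by blast
    qed
    moreover obtain X where X: "X \<in> C" using \<open>C \<noteq> {}\<close> by blast
    then have "ring_ideal X" "c \<in> X" using C(1) by (auto simp: P_def)
    then have "0 \<in> \<Union>C" "c \<in> \<Union>C" using X ring_ideal_zero[of X] by blast+
    moreover have "1 \<notin> \<Union>C"
      using C(1) by (auto simp: P_def)
    ultimately show ?thesis unfolding P_def ring_ideal_def by blast
  qed
  ultimately obtain I where I: "I \<in> P" and max: "\<And>J. J \<in> P \<Longrightarrow> I \<subseteq> J \<Longrightarrow> J = I"
    using subset_Zorn_nonempty[of P] by blast
  have idI: "ring_ideal I" using I by (simp add: P_def)
  have "\<exists>b. d * b - 1 \<in> I" if d: "d \<notin> I" for d
  proof -
    define J where "J = {i + d * r | i r. i \<in> I}"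
    have "ring_ideal J"
      unfolding ring_ideal_def
    proof (intro conjI ballI allI)
      show "0 \<in> J"
        unfolding J_def using ring_ideal_zero[OF idI]
        by (intro CollectI exI[of _ "0::'a"]) auto
    next
      fix x y assume "x \<in> J" "y \<in> J"
      then obtain i r j s where "x = i + d * r" "i \<in> I" "y = j + d * s" "j \<in> I"
        unfolding J_def by blast
      then show "x + y \<in> J"
        unfolding J_def using ring_ideal_add[OF idI, of i j]
        by (intro CollectI exI[of _ "i + j"] exI[of _ "r + s"]) (auto simp: algebra_simps)
    next
      fix x s assume "x \<in> J"
      then obtain i r where "x = i + d * r" "i \<in> I"
        unfolding J_def by blast
      then show "x * s \<in> J"
        unfolding J_def using ring_ideal_mult[OF idI, of i s]
        by (intro CollectI exI[of _ "i * s"] exI[of _ "r * s"]) (auto simp: algebra_simps)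
    qed
    moreover have "I \<subseteq> J"
    proof
      fix i assume "i \<in> I"
      then show "i \<in> J" unfolding J_def by (intro CollectI exI[of _ i] exI[of _ 0]) auto
    qed
    moreover have "d \<in> J"
      unfolding J_def using ring_ideal_zero[OF idI]
      by (intro CollectI exI[of _ "0::'a"] exI[of _ 1]) auto
    ultimately have "1 \<in> J" using max[of J] d I by (auto simp: P_def)
    then obtain i r where "1 = i + d * r" "i \<in> I" unfolding J_def by blast
    then have "d * r - 1 = - i" by (simp add: algebra_simps)
    then show ?thesis using ring_ideal_minus[OF idI \<open>i \<in> I\<close>] by metis
  qed
  then show ?thesis using that I by (auto simp: P_def)
qed

lemma infdist_less_obtain:
  assumes "I \<noteq> {}" "infdist x I < e"
  obtains i where "i \<in> I" "dist x i < e"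
proof -
  have "(INF i\<in>I. dist x i) < e" using assms by (simp add: infdist_notempty)
  then obtain i where "i \<in> I" "dist x i < e"
    using assms(1) by (meson cINF_less_iff bdd_below_image_dist)
  then show ?thesis using that by blast
qed

text \<open>
  Products of approximants work because \<open>x y - (x - i) (y - j)\<close> lies in the ideal. The unit keeps
  distance 1 because all elements at distance less than 1 from it are invertible.
\<close>

lemma quotient_seminorm:
  fixes I :: "'a::comm_cstar_algebra set"
  assumes I: "ring_ideal I" and proper: "1 \<notin> I"
  shows "submultiplicative_seminorm (\<lambda>x. infdist x I)"
proof
  have ne: "I \<noteq> {}" using ring_ideal_zero[OF I] by blast
  fix x y :: 'a
  show "infdist (x + y) I \<le> infdist x I + infdist y I"
  proof (rule field_le_epsilon)
    fix e :: real assume "0 < e"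
    obtain i where i: "i \<in> I" "dist x i < infdist x I + e / 2"
      using infdist_less_obtain[OF ne, of x "infdist x I + e / 2"] \<open>0 < e\<close> by auto
    obtain j where j: "j \<in> I" "dist y j < infdist y I + e / 2"
      using infdist_less_obtain[OF ne, of y "infdist y I + e / 2"] \<open>0 < e\<close> by auto
    have "infdist (x + y) I \<le> dist (x + y) (i + j)"
      using ring_ideal_add[OF I] i j by (intro infdist_le) auto
    also have "\<dots> \<le> dist x i + dist y j"
      by (rule dist_triangle_add)
    finally show "infdist (x + y) I \<le> infdist x I + infdist y I + e" using i j by simp
  qed
  show "infdist (x * y) I \<le> infdist x I * infdist y I"
  proof (rule field_le_epsilon)
    fix e :: real assume e: "0 < e"
    define K where "K = infdist x I + infdist y I + 1"
    have K: "0 < K" using infdist_nonneg[of x I] infdist_nonneg[of y I] by (simp add: K_def)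
    define d where "d = min 1 (e / K)"
    have d: "0 < d" "d \<le> 1" "d * K \<le> e" using e K by (auto simp: d_def min_def field_simps)
    obtain i where i: "i \<in> I" "dist x i < infdist x I + d"
      using infdist_less_obtain[OF ne, of x "infdist x I + d"] d by auto
    obtain j where j: "j \<in> I" "dist y j < infdist y I + d"
      using infdist_less_obtain[OF ne, of y "infdist y I + d"] d by auto
    have "i * y + j * (x - i) \<in> I"
      using ring_ideal_add[OF I] ring_ideal_mult[OF I] i j by blast
    then have "infdist (x * y) I \<le> dist (x * y) (i * y + j * (x - i))"
      by (rule infdist_le)
    also have "\<dots> = norm ((x - i) * (y - j))"
      by (simp add: dist_norm algebra_simps)
    also have "\<dots> \<le> dist x i * dist y j"
      unfolding dist_norm by (rule norm_mult_ineq)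
    also have "\<dots> \<le> (infdist x I + d) * (infdist y I + d)"
      using i j infdist_nonneg[of x I] d by (intro mult_mono) auto
    also have "\<dots> = infdist x I * infdist y I + d * (infdist x I + infdist y I + d)"
      by (simp add: algebra_simps)
    also have "\<dots> \<le> infdist x I * infdist y I + d * K"
      using d by (intro add_left_mono mult_left_mono) (auto simp: K_def)
    finally show "infdist (x * y) I \<le> infdist x I * infdist y I + e" using d by linarith
  qed
  show "infdist x I \<le> norm x"
    using infdist_le[OF ring_ideal_zero[OF I], of x] by (simp add: dist_norm)
  show "0 \<le> infdist x I" by (rule infdist_nonneg)
  show "1 \<le> infdist 1 I"
  proof (rule ccontr)
    assume "\<not> ?thesis"
    then obtain i where i: "i \<in> I" "norm (1 - i) < 1"
      using infdist_less_obtain[OF ne, of 1 1] by (auto simp: dist_norm)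
    then obtain s where "i * s = 1" using invertible_near_one[of "1 - i"] by auto
    then show False using ring_ideal_mult[OF I, of i s] i proper by simp
  qed
qed

definition character :: "('a::comm_cstar_algebra \<Rightarrow> complex) \<Rightarrow> bool" where
  "character \<phi> \<longleftrightarrow> (\<forall>x y. \<phi> (x + y) = \<phi> x + \<phi> y) \<and> (\<forall>x y. \<phi> (x * y) = \<phi> x * \<phi> y) \<and>
     (\<forall>z. \<phi> (cscalar z) = z)"

lemma character_add: "character \<phi> \<Longrightarrow> \<phi> (x + y) = \<phi> x + \<phi> y"
  and character_mult: "character \<phi> \<Longrightarrow> \<phi> (x * y) = \<phi> x * \<phi> y"
  and character_cscalar: "character \<phi> \<Longrightarrow> \<phi> (cscalar z) = z"
  by (simp_all add: character_def)

lemma character_diff: "character \<phi> \<Longrightarrow> \<phi> (x - y) = \<phi> x - \<phi> y"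
  using character_add[of \<phi> "x - y" y] by simp

lemma character_sum: "character \<phi> \<Longrightarrow> \<phi> (\<Sum>i\<in>I. f i) = (\<Sum>i\<in>I. \<phi> (f i))"
  using character_cscalar[of \<phi> 0]
  by (induction I rule: infinite_finite_induct) (simp_all add: character_add[of \<phi>])

text \<open>
  In a maximal ideal \<open>I\<close> containing \<open>z\<^sub>0 - a\<close>, an element outside \<open>I\<close> has an inverse modulo \<open>I\<close>. As
  the spectrum for the quotient seminorm is nonempty, every \<open>x\<close> differs from a scalar by an
  element of \<open>I\<close>; that scalar is the value of the character.
\<close>

theorem spectrum_value_attained:
  fixes a :: "'a::comm_cstar_algebra"
  assumes z0: "z0 \<in> cstar_spectrum a"
  obtains \<phi> where "character \<phi>" "\<phi> a = z0"
proof -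
  have "\<nexists>b. (cscalar z0 - a) * b = 1"
    using z0 by (auto simp: cstar_spectrum_def mult.commute)
  then obtain I where I: "ring_ideal I" "cscalar z0 - a \<in> I" "1 \<notin> I"
    and max: "\<And>d. d \<notin> I \<Longrightarrow> \<exists>b. d * b - 1 \<in> I"
    using maximal_ideal_exists by metis
  interpret submultiplicative_seminorm "\<lambda>x. infdist x I"
    using quotient_seminorm[OF I(1,3)] .
  have ex: "\<exists>z. cscalar z - x \<in> I" for x
    using spectrum_nonempty[of x] max infdist_zero by metis
  have uniq: "z = w" if "cscalar z - x \<in> I" "cscalar w - x \<in> I" for z w x
  proof (rule ccontr)
    assume "z \<noteq> w"
    have "cscalar (z - w) \<in> I"
      using ring_ideal_diff[OF I(1) that] by (simp add: cscalar_diff)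
    then have "cscalar (z - w) * cscalar (1 / (z - w)) \<in> I"
      by (rule ring_ideal_mult[OF I(1)])
    then show False using \<open>z \<noteq> w\<close> I(3) by (simp add: cscalar_mult[symmetric])
  qed
  define \<phi> where "\<phi> x = (SOME z. cscalar z - x \<in> I)" for x
  have \<phi>: "cscalar (\<phi> x) - x \<in> I" for x
    unfolding \<phi>_def using ex[of x] by (rule someI_ex)
  have \<phi>_eq: "\<phi> x = z" if "cscalar z - x \<in> I" for x z
    using uniq[OF \<phi> that] .
  have "character \<phi>"
    unfolding character_def
  proof (intro conjI allI)
    fix x y
    show "\<phi> (x + y) = \<phi> x + \<phi> y"
      using ring_ideal_add[OF I(1) \<phi>[of x] \<phi>[of y]]
      by (intro \<phi>_eq) (simp add: scaleC_add_left algebra_simps)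
    have "(cscalar (\<phi> x) - x) * cscalar (\<phi> y) + (cscalar (\<phi> y) - y) * x \<in> I"
      using ring_ideal_add[OF I(1)] ring_ideal_mult[OF I(1)] \<phi> by blast
    moreover have "(cscalar (\<phi> x) - x) * cscalar (\<phi> y) + (cscalar (\<phi> y) - y) * x =
        cscalar (\<phi> x * \<phi> y) - x * y"
      unfolding cscalar_mult by (simp add: algebra_simps)
    ultimately show "\<phi> (x * y) = \<phi> x * \<phi> y"
      by (intro \<phi>_eq) simp
  next
    fix z
    show "\<phi> (cscalar z) = z"
      by (intro \<phi>_eq) (simp add: ring_ideal_zero[OF I(1)])
  qed
  moreover have "\<phi> a = z0" using I(2) by (rule \<phi>_eq)
  ultimately show ?thesis using that by blast
qed

lemma character_in_spectrum:
  assumes "character \<phi>"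
  shows "\<phi> a \<in> cstar_spectrum a"
proof -
  have "(cscalar (\<phi> a) - a) * b \<noteq> 1" for b
  proof
    assume "(cscalar (\<phi> a) - a) * b = 1"
    then have "\<phi> ((cscalar (\<phi> a) - a) * b) = \<phi> (cscalar 1)" by simp
    then show False
      by (simp only: character_mult[OF assms] character_diff[OF assms] character_cscalar[OF assms])
        simp
  qed
  then show ?thesis by (simp add: cstar_spectrum_def)
qed

text \<open>If \<open>\<phi> x\<close> exceeded the norm of \<open>x\<close>, then \<open>1 - x / \<phi> x\<close> would be invertible and in the kernel.\<close>

lemma character_norm_le:
  assumes \<phi>: "character \<phi>"
  shows "cmod (\<phi> x) \<le> norm x"
proof (rule ccontr)
  assume less: "\<not> ?thesis"
  then have ne: "\<phi> x \<noteq> 0" by auto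
  have "norm (cscalar (1 / \<phi> x) * x) \<le> cmod (1 / \<phi> x) * norm x"
    using norm_mult_ineq[of "cscalar (1 / \<phi> x)" x] by simp
  also have "\<dots> < 1" using less ne by (simp add: norm_divide divide_simps)
  finally obtain s where "(1 - cscalar (1 / \<phi> x) * x) * s = 1"
    using invertible_near_one by blast
  then have "\<phi> ((cscalar 1 - cscalar (1 / \<phi> x) * x) * s) = \<phi> (cscalar 1)" by simp
  then show False
    using ne by (simp only: character_mult[OF \<phi>] character_diff[OF \<phi>] character_cscalar[OF \<phi>])
      simp
qed

text \<open>
  Adding an imaginary scalar \<open>\<i> t\<close> to \<open>h\<close> increases the square of the norm by at most \<open>t\<^sup>2\<close>, by the
  C*-identity, but it would increase \<open>\<bar>\<phi> h\<bar>\<^sup>2\<close> by \<open>2 t Im (\<phi> h) + t\<^sup>2\<close>, where \<open>t\<close> is arbitrary.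
\<close>

lemma character_self_adjoint_real:
  assumes \<phi>: "character \<phi>" and h: "star h = h"
  shows "Im (\<phi> h) = 0"
proof -
  let ?b = "Im (\<phi> h)"
  have bound: "2 * t * ?b \<le> (norm h)\<^sup>2" for t
  proof -
    define x where "x = h + cscalar (\<i> * complex_of_real t)"
    have "star x * x =
        (h - cscalar (\<i> * complex_of_real t)) * (h + cscalar (\<i> * complex_of_real t))"
      using h by (simp add: x_def star_add star_cscalar cscalar_minus)
    also have "\<dots> = h * h - cscalar (\<i> * complex_of_real t) * cscalar (\<i> * complex_of_real t)"
      by (simp add: algebra_simps)
    also have "\<dots> = h * h + of_real (t * t)"
    proof -
      have "\<i> * complex_of_real t * (\<i> * complex_of_real t) = - complex_of_real (t * t)"
        by (simp add: algebra_simps)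
      then show ?thesis
        by (simp only: cscalar_mult[symmetric] cscalar_minus cscalar_of_real diff_minus_eq_add)
    qed
    finally have "norm (star x * x) \<le> norm (h * h) + norm (of_real (t * t) :: 'a)"
      using norm_triangle_ineq[of "h * h" "of_real (t * t)"] by simp
    then have "(norm x)\<^sup>2 \<le> (norm h)\<^sup>2 + t\<^sup>2"
      using norm_mult_ineq[of h h]
      by (simp add: norm_star_mult_self power2_eq_square del: of_real_mult)
    moreover have "\<phi> x = \<phi> h + \<i> * complex_of_real t"
      by (simp add: x_def character_add[OF \<phi>] character_cscalar[OF \<phi>])
    then have "(cmod (\<phi> x))\<^sup>2 = (Re (\<phi> h))\<^sup>2 + (?b + t)\<^sup>2"
      by (simp add: cmod_power2)
    moreover have "(cmod (\<phi> x))\<^sup>2 \<le> (norm x)\<^sup>2"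
      using character_norm_le[OF \<phi>, of x] by (intro power_mono) auto
    ultimately have "(Re (\<phi> h))\<^sup>2 + (?b + t)\<^sup>2 \<le> (norm h)\<^sup>2 + t\<^sup>2" by linarith
    moreover have "(?b + t)\<^sup>2 = ?b\<^sup>2 + 2 * t * ?b + t\<^sup>2"
      by (simp add: power2_eq_square algebra_simps)
    ultimately show ?thesis
      using zero_le_power2[of "Re (\<phi> h)"] zero_le_power2[of ?b] by linarith
  qed
  show ?thesis
  proof (rule ccontr)
    assume "?b \<noteq> 0"
    then have "2 * (((norm h)\<^sup>2 + 1) / ?b) * ?b = 2 * (norm h)\<^sup>2 + 2" by simp
    then show False
      using bound[of "((norm h)\<^sup>2 + 1) / ?b"] zero_le_power2[of "norm h"] by linarith
  qed
qed

lemma character_star: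
  assumes \<phi>: "character \<phi>"
  shows "\<phi> (star x) = cnj (\<phi> x)"
proof -
  have "star (x + star x) = x + star x"
    by (simp add: star_add star_star add.commute)
  then have "Im (\<phi> (x + star x)) = 0"
    by (rule character_self_adjoint_real[OF \<phi>])
  then have im: "Im (\<phi> (star x)) = - Im (\<phi> x)"
    by (simp add: character_add[OF \<phi>])
  define y where "y = cscalar \<i> * (x - star x)"
  have "star y = y"
  proof -
    have "star y = (star x - x) * (- cscalar \<i>)"
      by (simp add: y_def star_mult star_diff star_star star_cscalar cscalar_minus)
    also have "\<dots> = y" by (simp add: y_def algebra_simps)
    finally show ?thesis .
  qed
  then have "Im (\<phi> y) = 0"
    by (rule character_self_adjoint_real[OF \<phi>])
  then have "Re (\<phi> (star x)) = Re (\<phi> x)"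
    by (simp add: y_def character_mult[OF \<phi>] character_cscalar[OF \<phi>] character_diff[OF \<phi>])
  with im show ?thesis by (simp add: complex_eq_iff)
qed

lemma cstar_nonneg_iff_characters:
  fixes a :: "'a::comm_cstar_algebra"
  shows "cstar_nonneg a \<longleftrightarrow> star a = a \<and> (\<forall>\<phi>. character \<phi> \<longrightarrow> 0 \<le> \<phi> a)"
proof -
  have nonneg: "complex_of_real ` {0..} = {z. 0 \<le> z}"
  proof (intro subset_antisym subsetI)
    fix z :: complex assume "z \<in> {z. 0 \<le> z}"
    then show "z \<in> complex_of_real ` {0..}"
      by (intro image_eqI[of _ _ "Re z"]) (auto simp: less_eq_complex_def complex_eq_iff)
  qed (auto simp: less_eq_complex_def)
  have "cstar_spectrum a \<subseteq> {z. 0 \<le> z} \<longleftrightarrow> (\<forall>\<phi>. character \<phi> \<longrightarrow> 0 \<le> \<phi> a)"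
  proof (intro iffI allI impI subsetI CollectI)
    fix \<phi> :: "'a \<Rightarrow> complex"
    assume "cstar_spectrum a \<subseteq> {z. 0 \<le> z}" "character \<phi>"
    then show "0 \<le> \<phi> a" using character_in_spectrum[of \<phi> a] by (meson CollectD subsetD)
  next
    fix z assume pos: "\<forall>\<phi>. character \<phi> \<longrightarrow> 0 \<le> \<phi> a" and "z \<in> cstar_spectrum a"
    from this(2) obtain \<phi> where \<phi>: "character \<phi>" "\<phi> a = z" by (rule spectrum_value_attained)
    show "0 \<le> z" using pos[rule_format, OF \<phi>(1)] by (simp only: \<phi>(2))
  qed
  then show ?thesis by (simp only: cstar_nonneg_def nonneg)
qed

section \<open>The Schur product of complex positive semidefinite matrices\<close>

definition sesquilinear_sum ::
    "'i set \<Rightarrow> ('i \<Rightarrow> 'i \<Rightarrow> complex) \<Rightarrow> ('i \<Rightarrow> complex) \<Rightarrow> complex" where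
  "sesquilinear_sum S P c = (\<Sum>j\<in>S. \<Sum>k\<in>S. P j k * c k * cnj (c j))"

lemma sesquilinear_sum_insert:
  assumes "finite S" "i \<notin> S"
  shows "sesquilinear_sum (insert i S) P c =
    P i i * c i * cnj (c i) + (\<Sum>k\<in>S. P i k * c k) * cnj (c i)
      + c i * (\<Sum>j\<in>S. P j i * cnj (c j)) + sesquilinear_sum S P c"
  using assms
  by (simp add: sesquilinear_sum_def sum.distrib sum_distrib_left sum_distrib_right algebra_simps)

lemma sesquilinear_sum_single:
  assumes "finite S" "i \<in> S"
  shows "sesquilinear_sum S P (\<lambda>k. if k = i then 1 else 0) = P i i"
proof -
  have "sesquilinear_sum S P (\<lambda>k. if k = i then 1 else 0) =
      (\<Sum>j\<in>S. \<Sum>k\<in>S. if k = i then (if j = i then P i i else 0) else 0)"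
    unfolding sesquilinear_sum_def by (intro sum.cong) auto
  then show ?thesis using assms by (simp add: sum.delta)
qed

text \<open>
  Otherwise the vector with entries 1 at \<open>j\<close> and \<open>- s cnj (Q j i)\<close> at \<open>i\<close> would give the form the value
  \<open>Q j j - 2 s \<bar>Q j i\<bar>\<^sup>2\<close>, which is negative for large \<open>s\<close>.
\<close>

lemma zero_pivot_row:
  assumes S: "finite S" "i \<notin> S" "j \<in> S"
    and herm: "Q i j = cnj (Q j i)"
    and pos: "\<And>c. 0 \<le> sesquilinear_sum (insert i S) Q c" and z: "Q i i = 0"
  shows "Q j i = 0"
proof (rule ccontr)
  assume ne: "Q j i \<noteq> 0"
  have "0 \<le> Re (Q j j) - 2 * s * (cmod (Q j i))\<^sup>2" for s
  proof -
    define c where "c k = (if k = j then 1 else if k = i then - of_real s * cnj (Q j i) else 0)" for k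
    have ij: "i \<noteq> j" using S by blast
    have "(\<Sum>k\<in>S. Q i k * c k) = (\<Sum>k\<in>S. if k = j then Q i j else 0)"
      using S by (intro sum.cong) (auto simp: c_def)
    then have 1: "(\<Sum>k\<in>S. Q i k * c k) = Q i j" using S by (simp add: sum.delta)
    have "(\<Sum>k\<in>S. Q k i * cnj (c k)) = (\<Sum>k\<in>S. if k = j then Q j i else 0)"
      using S by (intro sum.cong) (auto simp: c_def)
    then have 2: "(\<Sum>k\<in>S. Q k i * cnj (c k)) = Q j i" using S by (simp add: sum.delta)
    have "sesquilinear_sum S Q c = sesquilinear_sum S Q (\<lambda>k. if k = j then 1 else 0)"
      using S unfolding sesquilinear_sum_def by (intro sum.cong) (auto simp: c_def)
    then have 3: "sesquilinear_sum S Q c = Q j j"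
      using S sesquilinear_sum_single by metis
    have "sesquilinear_sum (insert i S) Q c =
        Q i j * cnj (c i) + c i * Q j i + Q j j"
      by (simp add: sesquilinear_sum_insert S 1 2 3 z)
    also have "\<dots> = Q j j - 2 * of_real s * (Q j i * cnj (Q j i))"
      using ij by (simp add: c_def herm algebra_simps)
    finally have "0 \<le> Q j j - 2 * of_real s * (Q j i * cnj (Q j i))" using pos[of c] by simp
    then show ?thesis
      by (simp add: complex_norm_square[symmetric] less_eq_complex_def mult_ac
          flip: of_real_power)
  qed
  from this[of "(Re (Q j j) + 1) / (2 * (cmod (Q j i))\<^sup>2)"] show False
    using ne by (simp add: field_simps)
qed

text \<open>
  Gaussian elimination: subtracting \<open>w w\<^sup>*\<close>, where \<open>w\<close> is the pivot column divided by the root of the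
  pivot, clears the row and the column of \<open>i\<close> and leaves a matrix \<open>Q'\<close> on \<open>S\<close> that is
  again positive semidefinite: its form at \<open>c\<close> is the form of \<open>Q\<close> at the extension \<open>c'\<close> of \<open>c\<close> that
  minimises it, namely the one with \<open>\<langle>c', w\<rangle> = 0\<close>.
\<close>

lemma gram_decomposition:
  assumes "finite S"
    and "\<And>j k. j \<in> S \<Longrightarrow> k \<in> S \<Longrightarrow> Q j k = cnj (Q k j)"
    and "\<And>c. 0 \<le> sesquilinear_sum S Q c"
  shows "\<exists>v. \<forall>j\<in>S. \<forall>k\<in>S. Q j k = (\<Sum>l\<in>S. v l j * cnj (v l k))"
  using assms
proof (induction S arbitrary: Q rule: finite_induct)
  case (insert i S)
  note herm = insert.prems(1) and pos = insert.prems(2)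
  have "0 \<le> Q i i"
    using pos[of "\<lambda>k. if k = i then 1 else 0"] insert.hyps by (simp add: sesquilinear_sum_single)
  then obtain p where p: "Q i i = of_real p" "0 \<le> p"
    by (metis complex_is_Real_iff less_eq_complex_def of_real_Re zero_complex.simps)
  \<comment> \<open>For a zero pivot the convention \<open>x / 0 = 0\<close> gives \<open>w = 0\<close>, which is the right choice because
    then the row of \<open>i\<close> vanishes.\<close>
  define w where "w j = Q j i / of_real (sqrt p)" for j
  have sq: "complex_of_real (sqrt p) * complex_of_real (sqrt p) = of_real p"
    using p(2) by (simp flip: of_real_mult)
  have wi: "Q j i = w j * cnj (w i)" if "j \<in> insert i S" for j
  proof (cases "p = 0")
    case True
    then have "Q j i = 0"
      using that p zero_pivot_row[of S i j Q] insert.hyps herm[of i j] pos by auto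
    then show ?thesis by (simp add: w_def)
  next
    case False
    then show ?thesis using sq by (simp add: w_def p(1) field_simps)
  qed
  then have wi': "Q i k = w i * cnj (w k)" if "k \<in> insert i S" for k
    using that herm[of i k] by simp
  define Q' where "Q' j k = Q j k - w j * cnj (w k)" for j k
  have "0 \<le> sesquilinear_sum S Q' c" for c
  proof -
    let ?W = "\<Sum>k\<in>S. cnj (w k) * c k"
    define c' where "c' = c(i := - ?W / cnj (w i))"
    have c'S: "k \<in> S \<Longrightarrow> c' k = c k" for k using insert.hyps by (auto simp: c'_def)
    have W: "cnj (w i) * c' i = - ?W"
    proof (cases "w i = 0")
      case True
      then have "p = 0" using sq p(1) by (auto simp: w_def)
      then have "w k = 0" for k by (simp add: w_def)
      then show ?thesis by simp
    qed (simp add: c'_def)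
    have rank_one: "sesquilinear_sum S (\<lambda>j k. w j * cnj (w k)) c = ?W * cnj ?W"
      unfolding sesquilinear_sum_def cnj_sum sum_distrib_left sum_distrib_right
      by (simp add: mult_ac)
    have "sesquilinear_sum (insert i S) Q c' =
        Q i i * c' i * cnj (c' i) + (\<Sum>k\<in>S. Q i k * c' k) * cnj (c' i)
        + c' i * (\<Sum>j\<in>S. Q j i * cnj (c' j)) + sesquilinear_sum S Q c'"
      using insert.hyps by (rule sesquilinear_sum_insert)
    also have "sesquilinear_sum S Q c' = sesquilinear_sum S Q c"
      unfolding sesquilinear_sum_def by (intro sum.cong) (auto simp: c'S)
    also have "(\<Sum>k\<in>S. Q i k * c' k) = w i * ?W"
      unfolding sum_distrib_left by (intro sum.cong) (auto simp: wi' c'S)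
    also have "(\<Sum>j\<in>S. Q j i * cnj (c' j)) = cnj (w i) * cnj ?W"
      unfolding cnj_sum sum_distrib_left by (intro sum.cong) (auto simp: wi c'S)
    also have "Q i i * c' i * cnj (c' i) = (cnj (w i) * c' i) * cnj (cnj (w i) * c' i)"
      using wi[of i] by simp
    also have "w i * ?W * cnj (c' i) = ?W * cnj (cnj (w i) * c' i)" by simp
    also have "c' i * (cnj (w i) * cnj ?W) = (cnj (w i) * c' i) * cnj ?W" by simp
    also have "(cnj (w i) * c' i) * cnj (cnj (w i) * c' i) + ?W * cnj (cnj (w i) * c' i)
        + (cnj (w i) * c' i) * cnj ?W + sesquilinear_sum S Q c
        = sesquilinear_sum S Q c - ?W * cnj ?W"
      unfolding W by (simp add: algebra_simps)
    also have "\<dots> = sesquilinear_sum S Q' c"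
      unfolding rank_one[symmetric]
      by (simp add: sesquilinear_sum_def Q'_def sum_subtractf algebra_simps)
    finally show ?thesis using pos[of c'] by simp
  qed
  moreover have "Q' j k = cnj (Q' k j)" if "j \<in> S" "k \<in> S" for j k
    using herm[of j k] that by (simp add: Q'_def)
  ultimately obtain v where v: "\<forall>j\<in>S. \<forall>k\<in>S. Q' j k = (\<Sum>l\<in>S. v l j * cnj (v l k))"
    using insert.IH by blast
  define u where "u l = (if l = i then w else (\<lambda>j. if j = i then 0 else v l j))" for l
  have "Q j k = (\<Sum>l\<in>insert i S. u l j * cnj (u l k))" if jk: "j \<in> insert i S" "k \<in> insert i S" for j k
  proof -
    have "(\<Sum>l\<in>insert i S. u l j * cnj (u l k)) = w j * cnj (w k) + (\<Sum>l\<in>S. u l j * cnj (u l k))"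
      using insert.hyps by (simp add: u_def)
    also have "(\<Sum>l\<in>S. u l j * cnj (u l k)) = Q j k - w j * cnj (w k)"
    proof (cases "j = i \<or> k = i")
      case True
      then have "(\<Sum>l\<in>S. u l j * cnj (u l k)) = 0"
        using insert.hyps by (intro sum.neutral) (auto simp: u_def)
      then show ?thesis using True wi[of j] wi'[of k] jk by auto
    next
      case False
      then have "(\<Sum>l\<in>S. u l j * cnj (u l k)) = (\<Sum>l\<in>S. v l j * cnj (v l k))"
        using insert.hyps by (intro sum.cong) (auto simp: u_def)
      also have "\<dots> = Q' j k" using v jk False by simp
      finally show ?thesis by (simp add: Q'_def)
    qed
    finally show ?thesis by simp
  qed
  then show ?case by blast
qed simp

text \<open>
  A rank one factor \<open>v v\<^sup>*\<close> can be absorbed into the argument: the form of \<open>P\<close> multiplied entrywise by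
  \<open>v v\<^sup>*\<close>, at \<open>c\<close>, is the form of \<open>P\<close> at the entrywise product of \<open>c\<close> with the conjugate of \<open>v\<close>.
\<close>

theorem complex_schur_product:
  assumes S: "finite S"
    and P: "\<And>c. 0 \<le> sesquilinear_sum S P c"
    and herm: "\<And>j k. j \<in> S \<Longrightarrow> k \<in> S \<Longrightarrow> Q j k = cnj (Q k j)"
    and Q: "\<And>c. 0 \<le> sesquilinear_sum S Q c"
  shows "0 \<le> sesquilinear_sum S (\<lambda>j k. P j k * Q j k) c"
proof -
  obtain v where v: "\<forall>j\<in>S. \<forall>k\<in>S. Q j k = (\<Sum>l\<in>S. v l j * cnj (v l k))"
    using gram_decomposition[OF S herm Q] by blast
  have "sesquilinear_sum S (\<lambda>j k. P j k * Q j k) c =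
      (\<Sum>j\<in>S. \<Sum>k\<in>S. \<Sum>l\<in>S. P j k * (c k * cnj (v l k)) * cnj (c j * cnj (v l j)))"
    unfolding sesquilinear_sum_def
    using v by (intro sum.cong refl) (simp add: sum_distrib_left sum_distrib_right mult_ac)
  also have "\<dots> = (\<Sum>j\<in>S. \<Sum>l\<in>S. \<Sum>k\<in>S. P j k * (c k * cnj (v l k)) * cnj (c j * cnj (v l j)))"
    by (intro sum.cong refl sum.swap)
  also have "\<dots> = (\<Sum>l\<in>S. sesquilinear_sum S P (\<lambda>k. c k * cnj (v l k)))"
    unfolding sesquilinear_sum_def by (rule sum.swap)
  also have "0 \<le> \<dots>" by (intro sum_nonneg P)
  finally show ?thesis .
qed

section \<open>Positive matrices over a commutative C*-algebra\<close>

lemma vec_cinner_mult_mat_vec: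
  assumes "A \<in> carrier_mat n n" "x \<in> carrier_vec n"
  shows "vec_cinner (A *\<^sub>v x) x = (\<Sum>j<n. \<Sum>k<n. A $$ (j, k) * x $ k * star (x $ j))"
  using assms
  by (auto simp: vec_cinner_def scalar_prod_def sum_distrib_right lessThan_atLeast0
      intro!: sum.cong)

lemma mat_star_eq_iff:
  assumes "A \<in> carrier_mat n n"
  shows "mat_star A = A \<longleftrightarrow> (\<forall>j<n. \<forall>k<n. star (A $$ (k, j)) = A $$ (j, k))"
  using assms by (auto simp: mat_star_def mat_eq_iff)

text \<open>
  A character takes \<open>\<langle>A x, x\<rangle>\<close> to the form of the image matrix at the image vector, and every complex
  vector is such an image, namely that of the same vector regarded as a vector of scalars of the
  algebra.
\<close>

lemma mat_positive_iff_characters: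
  fixes A :: "'a::comm_cstar_algebra mat"
  shows "mat_positive n A \<longleftrightarrow> A \<in> carrier_mat n n \<and> mat_star A = A \<and>
    (\<forall>\<phi> c. character \<phi> \<longrightarrow> 0 \<le> sesquilinear_sum {..<n} (\<lambda>j k. \<phi> (A $$ (j, k))) c)"
proof (cases "A \<in> carrier_mat n n \<and> mat_star A = A")
  case True
  then have A: "A \<in> carrier_mat n n" and "mat_star A = A" by auto
  then have herm: "star (A $$ (k, j)) = A $$ (j, k)" if "j < n" "k < n" for j k
    using that mat_star_eq_iff by blast
  have inner: "\<phi> (vec_cinner (A *\<^sub>v x) x) =
      sesquilinear_sum {..<n} (\<lambda>j k. \<phi> (A $$ (j, k))) (\<lambda>k. \<phi> (x $ k))"
    if "character \<phi>" "x \<in> carrier_vec n" for \<phi> x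
    using that(2) A by (simp add: vec_cinner_mult_mat_vec sesquilinear_sum_def
        character_sum[OF that(1)] character_mult[OF that(1)] character_star[OF that(1)])
  have self_adjoint: "star (vec_cinner (A *\<^sub>v x) x) = vec_cinner (A *\<^sub>v x) x"
    if "x \<in> carrier_vec n" for x
  proof -
    have "star (vec_cinner (A *\<^sub>v x) x) = (\<Sum>j<n. \<Sum>k<n. A $$ (k, j) * x $ j * star (x $ k))"
      using that A
      by (auto simp: vec_cinner_mult_mat_vec star_sum star_mult star_star herm mult_ac
          intro!: sum.cong)
    also have "\<dots> = vec_cinner (A *\<^sub>v x) x"
      using that A by (subst sum.swap) (simp add: vec_cinner_mult_mat_vec)
    finally show ?thesis .
  qed
  have "(\<forall>x\<in>carrier_vec n. cstar_nonneg (vec_cinner (A *\<^sub>v x) x)) \<longleftrightarrow>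
      (\<forall>\<phi> c. character \<phi> \<longrightarrow> 0 \<le> sesquilinear_sum {..<n} (\<lambda>j k. \<phi> (A $$ (j, k))) c)"
  proof (intro iffI allI impI ballI)
    fix \<phi> :: "'a \<Rightarrow> complex" and c
    assume pos: "\<forall>x\<in>carrier_vec n. cstar_nonneg (vec_cinner (A *\<^sub>v x) x)" and \<phi>: "character \<phi>"
    define x :: "'a Matrix.vec" where "x = Matrix.vec n (\<lambda>k. cscalar (c k))"
    have x: "x \<in> carrier_vec n" by (simp add: x_def)
    then have "0 \<le> \<phi> (vec_cinner (A *\<^sub>v x) x)"
      using pos \<phi> by (simp add: cstar_nonneg_iff_characters)
    also have "\<phi> (vec_cinner (A *\<^sub>v x) x) = sesquilinear_sum {..<n} (\<lambda>j k. \<phi> (A $$ (j, k))) c"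
      unfolding inner[OF \<phi> x] sesquilinear_sum_def
      by (intro sum.cong) (auto simp: x_def character_cscalar[OF \<phi>])
    finally show "0 \<le> sesquilinear_sum {..<n} (\<lambda>j k. \<phi> (A $$ (j, k))) c" .
  qed (auto simp: cstar_nonneg_iff_characters inner self_adjoint)
  then show ?thesis using True by (simp add: mat_positive_def)
qed (auto simp: mat_positive_def)

lemma schur_product_commutative:
  fixes A B :: "'a::comm_cstar_algebra mat"
  assumes "A \<in> carrier_mat n n" "j < n" "k < n"
  shows "schur_product A B $$ (j, k) = A $$ (j, k) * B $$ (j, k)"
proof -
  have "(1 / 2) *\<^sub>R (x + x) = x" for x :: 'a
    by (simp flip: scaleR_add_left scaleR_2)
  then show ?thesis using assms by (simp add: schur_product_def mult.commute)
qed

theorem theorem2p3: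
  fixes M N :: "'a::comm_cstar_algebra mat"
    and n :: nat
  assumes "M \<in> carrier_mat n n" and "N \<in> carrier_mat n n"
    and "mat_positive n M" and "mat_positive n N"
  shows "mat_positive n (schur_product M N)"
proof -
  let ?S = "schur_product M N"
  have S: "?S \<in> carrier_mat n n"
    using assms(1) by (simp add: schur_product_def)
  have entries: "?S $$ (j, k) = M $$ (j, k) * N $$ (j, k)" if "j < n" "k < n" for j k
    using schur_product_commutative assms(1) that by blast
  have hermM: "star (M $$ (k, j)) = M $$ (j, k)" if "j < n" "k < n" for j k
    using that assms mat_star_eq_iff mat_positive_def by blast
  have hermN: "star (N $$ (k, j)) = N $$ (j, k)" if "j < n" "k < n" for j k
    using that assms mat_star_eq_iff mat_positive_def by blast
  have "mat_star ?S = ?S"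
    unfolding mat_star_eq_iff[OF S] by (simp add: entries star_mult hermM hermN mult.commute)
  moreover have "0 \<le> sesquilinear_sum {..<n} (\<lambda>j k. \<phi> (?S $$ (j, k))) c"
    if \<phi>: "character \<phi>" for \<phi> c
  proof -
    have "sesquilinear_sum {..<n} (\<lambda>j k. \<phi> (?S $$ (j, k))) c =
        sesquilinear_sum {..<n} (\<lambda>j k. \<phi> (M $$ (j, k)) * \<phi> (N $$ (j, k))) c"
      unfolding sesquilinear_sum_def
      by (intro sum.cong) (auto simp: entries character_mult[OF \<phi>])
    also have "0 \<le> \<dots>"
    proof (rule complex_schur_product)
      fix j k assume "j \<in> {..<n}" "k \<in> {..<n}"
      then show "\<phi> (N $$ (j, k)) = cnj (\<phi> (N $$ (k, j)))"
        by (simp add: hermN flip: character_star[OF \<phi>])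
    qed (use assms \<phi> in \<open>auto simp: mat_positive_iff_characters\<close>)
    finally show ?thesis .
  qed
  ultimately show ?thesis using S by (simp add: mat_positive_iff_characters)
qed

end
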